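(* Suppose there exists a constant $M>0$ such that for all $y\in\mathrm{dom}(h)\cap\mathrm{dom}(\Psi)$, $g\in\partial f(y)$, $s\in\mathrm{dom}(h)\cap\mathrm{dom}(\Psi)$ and $t>0$ $$\frac{M^2t^2}{2}+ t\left( \Psi(s) - \Psi(y) + \langle g,s-y\rangle \right) + D_h(s,y)\ge 0.$$ Then the sequence $z_k$, $k=1,2,\dots$, generated by the Bregman proximal subgradient algorithm described in the context satisfies $$f(z_k) + \Psi(z_k) + f^*(u_k) + (\Psi+d_k)^*(-u_k) \le \frac{M^2\sum_{i=0}^{k-1} t_i^2/2}{\sum_{i=0}^{k-1} t_i}.$$ In particular, for all $x \in E$ $$f(z_k) +\Psi(z_k) - (f(x) + \Psi(x)) \le \frac{D_h(x, z_0) +M^2\sum_{i=0}^{k-1} t_i^2/2}{\sum_{i=0}^{k-1} t_i},$$ and thus if $t_i:=C/\sqrt{k}$, $i=0,1,\dots,k-1$, for some constant $C>0$, then $$f(z_k) +\Psi(z_k) - (f(x) + \Psi(x)) \le \frac{D_h(x, z_0)}{C\sqrt{k}} + \frac{C M^2}{2\sqrt{k}}.$$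
   Context: Setting. $E$ is a real vector space with continuous dual $E^*$ and pairing $\langle\cdot,\cdot\rangle$; $f,\Psi:E\to\mathbb{R}\cup\{\infty\}$ are closed convex with $\mathrm{dom}(\Psi)\subseteq\mathrm{dom}(\partial f)$ ($f$ need not be differentiable); $h:E\to\mathbb{R}\cup\{\infty\}$ is a convex differentiable reference function with $\mathrm{dom}(\Psi)\subseteq\overline{\mathrm{dom}(h)}$. $D_h(s,z)=h(s)-h(z)-\langle\nabla h(z),s-z\rangle$ (equal to $+\infty$ if $s\notin\mathrm{dom}(h)$). For a function $\phi$, $\phi^*(v)=\sup_x\{\langle v,x\rangle-\phi(x)\}$. Admissibility. $t>0$ is admissible for $(s_-,g)$ if $\min_s\{t(\langle g,s\rangle+\Psi(s))+D_h(s,s_-)\}$ has a solution $\bar s$ satisfying $t(g+g^\Psi)+\nabla h(\bar s)-\nabla h(s_-)=0$ for some $g^\Psi\in\partial\Psi(\bar s)$. Standing assumptions. (a) $f+\Psi$ is bounded below. (b) If $t>0$ and $(s_-,g)$ are such that $s\mapsto t(\langle g,s\rangle+\Psi(s))+D_h(s,s_-)$ is bounded below, then $t$ is admissible for $(s_-,g)$. (c) There is an oracle that, given $(t,s_-,g)$, either determines that $t$ is not admissible for $(s_-,g)$ or returns an optimal solution $\bar s$ of $\min_s\{t(\langle g,s\rangle+\Psi(s))+D_h(s,s_-)\}$ satisfying $t(g+g^\Psi)+\nabla h(\bar s)-\nabla h(s_-)=0$ for some $g^\Psi\in\partial\Psi(\bar s)$. Algorithm. Input $s_{-1}\in\mathrm{dom}(\Psi)\cap\mathrm{dom}(h)$.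 For $k=0,1,\dots$: pick $g_k\in\partial f(s_{k-1})$; pick $t_k>0$; pick $s_k\in\mathrm{argmin}_s\{t_k(\langle g_k,s\rangle+\Psi(s))+D_h(s,s_{k-1})\}$ satisfying the optimality conditions $t_k(g_k+g_k^\Psi)+\nabla h(s_k)-\nabla h(s_{k-1})=0$ for some $g_k^\Psi\in\partial\Psi(s_k)$ (such a minimizer is assumed to exist). Averages. With $y_k=s_{k-1}$: $z_0=s_{-1}$ and, for $k\ge1$, $z_k=\sum_{i=0}^{k-1}t_iy_i/\sum_{i=0}^{k-1}t_i$, $u_k=\sum_{i=0}^{k-1}t_ig_i/\sum_{i=0}^{k-1}t_i$, and $d_k(s)=D_h(s,s_{-1})/\sum_{i=0}^{k-1}t_i$. *)

theory Defs
  imports "HOL-Analysis.Analysis"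
begin

text \<open>The ambient space is an arbitrary real topological vector space; no norm, completeness or
  finite dimension is assumed.\<close>

class real_topological_vector = real_vector + topological_ab_group_add +
  assumes tendsto_scaleR_nhds:
    "((\<lambda>p. fst p *\<^sub>R snd p) \<longlongrightarrow> r *\<^sub>R x) (nhds (r::real) \<times>\<^sub>F nhds x)"

instance real_normed_vector \<subseteq> real_topological_vector
proof
  fix r :: real and x :: 'a
  have "((\<lambda>p. fst p *\<^sub>R snd p) \<longlongrightarrow> fst (r, x) *\<^sub>R snd (r, x)) (nhds (r, x))"
    by (intro tendsto_scaleR tendsto_fst tendsto_snd filterlim_ident)
  then show "((\<lambda>p. fst p *\<^sub>R snd p) \<longlongrightarrow> r *\<^sub>R x) (nhds r \<times>\<^sub>F nhds x)"
    by (simp add: nhds_prod)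
qed

text \<open>Elements of the dual are functions, so the pairing is application, and sums and multiples of
  functionals are written pointwise.\<close>

definition dual :: "('a::real_topological_vector \<Rightarrow> real) set" where
  "dual = {v. linear v \<and> continuous_on UNIV v}"


section \<open>Extended-real-valued convex functions\<close>

definition edom :: "('a \<Rightarrow> ereal) \<Rightarrow> 'a set" where
  "edom \<phi> = {x. \<phi> x < \<infinity>}"

definition epi :: "('a \<Rightarrow> ereal) \<Rightarrow> ('a \<times> real) set" where
  "epi \<phi> = {(x, r). \<phi> x \<le> ereal r}"

definition convex_fun :: "('a::real_vector \<Rightarrow> ereal) \<Rightarrow> bool" where
  "convex_fun \<phi> \<longleftrightarrow> (\<forall>x. \<phi> x \<noteq> -\<infinity>) \<and> convex (epi \<phi>)"

definition closed_convex_fun :: "('a::real_topological_vector \<Rightarrow> ereal) \<Rightarrow> bool" where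
  "closed_convex_fun \<phi> \<longleftrightarrow> convex_fun \<phi> \<and> closed (epi \<phi>)"

definition subdiff :: "('a::real_topological_vector \<Rightarrow> ereal) \<Rightarrow> 'a \<Rightarrow> ('a \<Rightarrow> real) set" where
  "subdiff \<phi> x = {g \<in> dual. x \<in> edom \<phi> \<and> (\<forall>y. \<phi> x + ereal (g (y - x)) \<le> \<phi> y)}"

definition fenchel_conj :: "('a \<Rightarrow> ereal) \<Rightarrow> ('a \<Rightarrow> real) \<Rightarrow> ereal" where
  "fenchel_conj \<phi> v = (SUP x. ereal (v x) - \<phi> x)"


section \<open>Differentiability and Bregman distance\<close>

text \<open>Gateaux differentiability with gradient in the dual. The quotients are taken in
  \<^typ>\<open>ereal\<close>: since the limit is finite, the function must be finite near the
  point on every line through it.\<close>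

definition has_gradient ::
    "('a::real_topological_vector \<Rightarrow> ereal) \<Rightarrow> ('a \<Rightarrow> real) \<Rightarrow> 'a \<Rightarrow> bool" where
  "has_gradient h v z \<longleftrightarrow> v \<in> dual \<and> \<bar>h z\<bar> \<noteq> \<infinity> \<and>
     (\<forall>d. ((\<lambda>r. (h (z + r *\<^sub>R d) - h z) / ereal r) \<longlongrightarrow> ereal (v d)) (at 0))"

definition differentiable_fun :: "('a::real_topological_vector \<Rightarrow> ereal) \<Rightarrow> bool" where
  "differentiable_fun h \<longleftrightarrow> (\<forall>z \<in> edom h. \<exists>v. has_gradient h v z)"

definition grad :: "('a::real_topological_vector \<Rightarrow> ereal) \<Rightarrow> 'a \<Rightarrow> 'a \<Rightarrow> real" where
  "grad h z = (THE v. has_gradient h v z)"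

lemma has_gradient_unique:
  assumes "has_gradient h v z" and "has_gradient h w z"
  shows "v = w"
proof
  fix d
  have "ereal (v d) = ereal (w d)"
    using assms unfolding has_gradient_def
    by (intro tendsto_unique[of "at (0::real)" "\<lambda>r. (h (z + r *\<^sub>R d) - h z) / ereal r"]) auto
  then show "v d = w d" by simp
qed

lemma grad_eq: "has_gradient h v z \<Longrightarrow> grad h z = v"
  unfolding grad_def using has_gradient_unique by blast

text \<open>In a normed space, Frechet differentiability is a special case.\<close>

lemma has_derivative_imp_has_gradient:
  fixes h :: "'a::real_normed_vector \<Rightarrow> ereal"
  assumes fin: "eventually (\<lambda>x. \<bar>h x\<bar> \<noteq> \<infinity>) (nhds z)"
    and der: "((\<lambda>x. real_of_ereal (h x)) has_derivative v) (at z)"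
  shows "has_gradient h v z"
  unfolding has_gradient_def
proof (intro conjI allI)
  have bl: "bounded_linear v" using der by (rule has_derivative_bounded_linear)
  then show "v \<in> dual"
    by (simp add: dual_def bounded_linear.linear linear_continuous_on)
  show hz: "\<bar>h z\<bar> \<noteq> \<infinity>" using fin by (rule eventually_nhds_x_imp_x)
  fix d
  let ?k = "\<lambda>x. real_of_ereal (h x)"
  have line: "((\<lambda>r. z + r *\<^sub>R d) has_derivative (\<lambda>r. r *\<^sub>R d)) (at 0)"
    by (auto intro!: derivative_eq_intros)
  have "((\<lambda>r. ?k (z + r *\<^sub>R d)) has_derivative (\<lambda>r. v (r *\<^sub>R d))) (at 0)"
    using has_derivative_compose[OF line, of ?k v] der by simp
  then have "((\<lambda>r. ?k (z + r *\<^sub>R d)) has_field_derivative v d) (at 0)"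
    unfolding has_field_derivative_def
    by (rule has_derivative_eq_rhs) (auto simp: fun_eq_iff linear_cmul[OF bounded_linear.linear[OF bl]])
  then have lim: "((\<lambda>r. ereal ((?k (z + r *\<^sub>R d) - ?k z) / r)) \<longlongrightarrow> ereal (v d)) (at 0)"
    by (simp add: DERIV_def)
  have "((\<lambda>r. z + r *\<^sub>R d) \<longlongrightarrow> z + 0 *\<^sub>R d) (at 0)"
    by (intro tendsto_intros)
  then have "eventually (\<lambda>r. \<bar>h (z + r *\<^sub>R d)\<bar> \<noteq> \<infinity>) (at 0)"
    using fin by (auto simp: filterlim_iff)
  moreover have "eventually (\<lambda>r::real. r \<noteq> 0) (at 0)"
    by (simp add: eventually_at_filter)
  ultimately have "eventually (\<lambda>r. ereal ((?k (z + r *\<^sub>R d) - ?k z) / r) =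
      (h (z + r *\<^sub>R d) - h z) / ereal r) (at 0)"
  proof eventually_elim
    case (elim r)
    obtain a where a: "h (z + r *\<^sub>R d) = ereal a" using elim(1) by (cases "h (z + r *\<^sub>R d)") auto
    obtain b where b: "h z = ereal b" using hz by (cases "h z") auto
    show ?case using elim(2) by (simp add: a b)
  qed
  then show "((\<lambda>r. (h (z + r *\<^sub>R d) - h z) / ereal r) \<longlongrightarrow> ereal (v d)) (at 0)"
    using lim by (rule tendsto_cong[THEN iffD1])
qed

text \<open>Only meaningful for \<^term>\<open>z \<in> edom h\<close>; then the value is \<open>\<infinity>\<close> outside
  \<^term>\<open>edom h\<close>.\<close>

definition bregman :: "('a::real_topological_vector \<Rightarrow> ereal) \<Rightarrow> 'a \<Rightarrow> 'a \<Rightarrow> ereal" where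
  "bregman h s z = h s - h z - ereal (grad h z (s - z))"


section \<open>Bregman proximal subgradient algorithm\<close>

definition prox_obj ::
    "('a::real_topological_vector \<Rightarrow> ereal) \<Rightarrow> ('a \<Rightarrow> ereal) \<Rightarrow> real \<Rightarrow> 'a \<Rightarrow> ('a \<Rightarrow> real) \<Rightarrow> 'a \<Rightarrow> ereal" where
  "prox_obj \<Psi> h t s' g s = ereal t * (ereal (g s) + \<Psi> s) + bregman h s s'"

definition prox_solution ::
    "('a::real_topological_vector \<Rightarrow> ereal) \<Rightarrow> ('a \<Rightarrow> ereal) \<Rightarrow> real \<Rightarrow> 'a \<Rightarrow> ('a \<Rightarrow> real) \<Rightarrow> 'a \<Rightarrow> bool" where
  "prox_solution \<Psi> h t s' g s \<longleftrightarrow>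
     is_arg_min (prox_obj \<Psi> h t s' g) (\<lambda>_. True) s \<and>
     (\<exists>g\<Psi> \<in> subdiff \<Psi> s. \<forall>v. t * (g v + g\<Psi> v) + grad h s v - grad h s' v = 0)"

definition admissible ::
    "('a::real_topological_vector \<Rightarrow> ereal) \<Rightarrow> ('a \<Rightarrow> ereal) \<Rightarrow> real \<Rightarrow> 'a \<Rightarrow> ('a \<Rightarrow> real) \<Rightarrow> bool" where
  "admissible \<Psi> h t s' g \<longleftrightarrow> t > 0 \<and> (\<exists>s. prox_solution \<Psi> h t s' g s)"

definition bounded_below :: "('a \<Rightarrow> ereal) \<Rightarrow> bool" where
  "bounded_below \<phi> \<longleftrightarrow> (\<exists>B::real. \<forall>x. ereal B \<le> \<phi> x)"

text \<open>A solver answers \<^const>\<open>None\<close> to report that the step size is not admissible.\<close>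

definition prox_solver ::
    "('a::real_topological_vector \<Rightarrow> ereal) \<Rightarrow> ('a \<Rightarrow> ereal) \<Rightarrow>
     (real \<Rightarrow> 'a \<Rightarrow> ('a \<Rightarrow> real) \<Rightarrow> 'a option) \<Rightarrow> bool" where
  "prox_solver \<Psi> h P \<longleftrightarrow> (\<forall>t>0. \<forall>s' \<in> edom h. \<forall>g \<in> dual.
     (case P t s' g of None \<Rightarrow> \<not> admissible \<Psi> h t s' g | Some s \<Rightarrow> prox_solution \<Psi> h t s' g s))"

text \<open>Iterates are shifted by one to avoid the index -1: \<open>y 0\<close> is the starting point and
  \<open>y (Suc k)\<close> is the point produced in iteration \<open>k\<close>.\<close>

definition bregman_prox_subgradient ::
    "('a::real_topological_vector \<Rightarrow> ereal) \<Rightarrow> ('a \<Rightarrow> ereal) \<Rightarrow> ('a \<Rightarrow> ereal) \<Rightarrow>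
     (nat \<Rightarrow> 'a) \<Rightarrow> (nat \<Rightarrow> 'a \<Rightarrow> real) \<Rightarrow> (nat \<Rightarrow> real) \<Rightarrow> bool" where
  "bregman_prox_subgradient f \<Psi> h y g t \<longleftrightarrow>
     y 0 \<in> edom \<Psi> \<inter> edom h \<and>
     (\<forall>k. g k \<in> subdiff f (y k) \<and> t k > 0 \<and> prox_solution \<Psi> h (t k) (y k) (g k) (y (Suc k)))"

definition z_avg :: "(nat \<Rightarrow> real) \<Rightarrow> (nat \<Rightarrow> 'a::real_vector) \<Rightarrow> nat \<Rightarrow> 'a" where
  "z_avg t y k = (if k = 0 then y 0 else (\<Sum>i<k. t i *\<^sub>R y i) /\<^sub>R (\<Sum>i<k. t i))"

definition u_avg :: "(nat \<Rightarrow> real) \<Rightarrow> (nat \<Rightarrow> 'a \<Rightarrow> real) \<Rightarrow> nat \<Rightarrow> 'a \<Rightarrow> real" where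
  "u_avg t g k = (\<lambda>x. (\<Sum>i<k. t i * g i x) / (\<Sum>i<k. t i))"

definition d_fun ::
    "('a::real_topological_vector \<Rightarrow> ereal) \<Rightarrow> (nat \<Rightarrow> real) \<Rightarrow> (nat \<Rightarrow> 'a) \<Rightarrow> nat \<Rightarrow> 'a \<Rightarrow> ereal" where
  "d_fun h t y k = (\<lambda>s. bregman h s (y 0) / ereal (\<Sum>i<k. t i))"

end

theory Submission
  imports Defs
begin

text \<open>
  The proof is a primal-dual certificate. One iteration satisfies the three-point inequality of
  Bregman proximal maps (\<open>prox_three_point\<close>), which compares the new iterate with an arbitrary
  point \<open>s\<close>. It charges the linear model at the new iterate, whereas the averages in the theorem
  use the old one. The move back to the old iterate is paid for by the Bregman distance between the
  two iterates, which also appears in the three-point inequality, up to a deficit of at most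
  \<open>M\<^sup>2 t\<^sup>2 / 2\<close>: this is exactly what the hypothesis relating \<open>f\<close>, \<open>\<Psi>\<close> and \<open>h\<close> says.
  In the resulting inequality (\<open>prox_step\<close>) the distances from \<open>s\<close> to consecutive iterates
  telescope (\<open>telescoped_steps\<close>), and the last one can be dropped because Bregman distances of a
  convex function are nonnegative.

  After division by the sum of the step sizes, the telescoped inequality holds for every \<open>s\<close> and so
  bounds the conjugate of \<open>\<Psi> + d\<^sub>k\<close> at \<open>- u\<^sub>k\<close>. The subgradient inequalities for \<open>f\<close> bound the
  conjugate of \<open>f\<close> at \<open>u\<^sub>k\<close>, and Jensen's inequality bounds \<open>f + \<Psi>\<close> at the average \<open>z\<^sub>k\<close>.
  When the three bounds are added, the weighted averages of \<open>f (y\<^sub>i)\<close>, \<open>\<Psi> (y\<^sub>i)\<close> and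
  \<open>g\<^sub>i (y\<^sub>i)\<close> cancel, and only the accumulated costs remain (\<open>averaged_duality_gap\<close>). The bounds
  against a fixed \<open>x\<close> follow because \<open>x\<close> is a candidate in both conjugates
  (\<open>gap_imp_suboptimality\<close>).

  All functions are finite at the points that matter, so the arithmetic is done over the reals,
  through \<^const>\<open>real_of_ereal\<close>. A point at which a function is infinite contributes \<open>-\<infinity>\<close>
  to the supremum defining its conjugate, and so does not affect it.
\<close>

section \<open>Extended-real-valued convex functions\<close>

lemma convex_fun_real:
  assumes "convex_fun \<phi>" and "x \<in> edom \<phi>"
  shows "\<phi> x = ereal (real_of_ereal (\<phi> x))"
  using assms by (cases "\<phi> x") (auto simp: convex_fun_def edom_def)

lemma notin_edom: "x \<notin> edom \<phi> \<Longrightarrow> \<phi> x = \<infinity>"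
  by (simp add: edom_def)

text \<open>A convex combination of points of the epigraph lies in the epigraph.\<close>

lemma convex_fun_Jensen:
  fixes \<phi> :: "'a::real_vector \<Rightarrow> ereal"
  assumes "convex_fun \<phi>" and "finite I" and "\<And>i. i \<in> I \<Longrightarrow> 0 \<le> w i" and "(\<Sum>i\<in>I. w i) = 1"
    and "\<And>i. i \<in> I \<Longrightarrow> x i \<in> edom \<phi>"
  shows "\<phi> (\<Sum>i\<in>I. w i *\<^sub>R x i) \<le> ereal (\<Sum>i\<in>I. w i * real_of_ereal (\<phi> (x i)))"
proof -
  have "(\<Sum>i\<in>I. w i *\<^sub>R (x i, real_of_ereal (\<phi> (x i)))) \<in> epi \<phi>"
  proof (rule convex_sum)
    show "convex (epi \<phi>)" using assms(1) by (simp add: convex_fun_def)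
    fix i assume "i \<in> I"
    then show "(x i, real_of_ereal (\<phi> (x i))) \<in> epi \<phi>"
      using convex_fun_real[OF assms(1) assms(5)] by (simp add: epi_def)
  qed (use assms in auto)
  then show ?thesis
    by (simp add: epi_def sum_prod case_prod_beta fst_sum snd_sum)
qed

text \<open>The difference quotients of a convex function along the segment from \<open>z\<close> to \<open>s\<close> never exceed
  the full difference \<open>h s - h z\<close>, hence neither does their limit.\<close>

lemma has_gradient_imp_subgradient:
  assumes conv: "convex_fun h" and grd: "has_gradient h v z"
  shows "v \<in> subdiff h z"
proof -
  obtain b where b: "h z = ereal b" using grd by (cases "h z") (auto simp: has_gradient_def)
  have z: "z \<in> edom h" using b by (simp add: edom_def)
  have "h z + ereal (v (s - z)) \<le> h s" for s
  proof (cases "s \<in> edom h")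
    case False
    then show ?thesis by (simp add: notin_edom)
  next
    case True
    then obtain a where a: "h s = ereal a" using convex_fun_real[OF conv] by blast
    let ?q = "\<lambda>r. (h (z + r *\<^sub>R (s - z)) - h z) / ereal r"
    have lim: "(?q \<longlongrightarrow> ereal (v (s - z))) (at_right 0)"
      using grd by (auto simp: has_gradient_def intro: filterlim_mono[OF _ order_refl at_le])
    have "?q r \<le> ereal (a - b)" if r: "0 < r" "r < 1" for r :: real
    proof -
      have "(1 - r) *\<^sub>R (z, b) + r *\<^sub>R (s, a) \<in> epi h"
        using conv a b r by (intro convexD) (auto simp: convex_fun_def epi_def)
      then have "h (z + r *\<^sub>R (s - z)) \<le> ereal (b + r * (a - b))"
        by (simp add: epi_def algebra_simps)
      moreover from this obtain c where c: "h (z + r *\<^sub>R (s - z)) = ereal c"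
        using conv by (cases "h (z + r *\<^sub>R (s - z))") (auto simp: convex_fun_def)
      ultimately show ?thesis
        using r b by (simp add: divide_simps mult.commute)
    qed
    then have "eventually (\<lambda>r. ?q r \<le> ereal (a - b)) (at_right 0)"
      by (auto simp: eventually_at_right_field intro!: exI[of _ 1])
    then have "ereal (v (s - z)) \<le> ereal (a - b)"
      using lim by (intro tendsto_upperbound[of ?q]) auto
    then show ?thesis by (simp add: a b)
  qed
  then show ?thesis using grd z by (simp add: subdiff_def has_gradient_def)
qed

lemma grad_subdiff:
  assumes "convex_fun h" and "differentiable_fun h" and "z \<in> edom h"
  shows "grad h z \<in> subdiff h z"
proof -
  obtain v where "has_gradient h v z" using assms by (auto simp: differentiable_fun_def)
  then show ?thesis
    using has_gradient_imp_subgradient[OF assms(1)] by (simp add: grad_eq)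
qed

lemma grad_linear:
  assumes "convex_fun h" and "differentiable_fun h" and "z \<in> edom h"
  shows "linear (grad h z)"
  using grad_subdiff[OF assms] by (simp add: subdiff_def dual_def)


section \<open>Bregman distance\<close>

lemma bregman_real:
  assumes "convex_fun h" and "s \<in> edom h" and "z \<in> edom h"
  shows "bregman h s z
    = ereal (real_of_ereal (h s) - real_of_ereal (h z) - grad h z (s - z))"
  by (subst bregman_def, subst convex_fun_real[OF assms(1,2)], subst convex_fun_real[OF assms(1,3)])
    simp

lemma bregman_infinite:
  assumes "convex_fun h" and "s \<notin> edom h" and "z \<in> edom h"
  shows "bregman h s z = \<infinity>"
  unfolding bregman_def notin_edom[OF assms(2)]
  by (subst convex_fun_real[OF assms(1,3)]) simp

lemma bregman_nonneg:
  assumes "convex_fun h" and "differentiable_fun h" and "s \<in> edom h" and "z \<in> edom h"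
  shows "0 \<le> real_of_ereal (bregman h s z)"
proof -
  have "h z + ereal (grad h z (s - z)) \<le> h s"
    using grad_subdiff[OF assms(1,2,4)] by (simp add: subdiff_def)
  then have "real_of_ereal (h z) + grad h z (s - z) \<le> real_of_ereal (h s)"
    using convex_fun_real[OF assms(1,3)] convex_fun_real[OF assms(1,4)]
    by (metis ereal_less_eq(3) plus_ereal.simps(1))
  then show ?thesis by (simp add: bregman_real[OF assms(1,3,4)])
qed

lemma bregman_self:
  assumes "convex_fun h" and "differentiable_fun h" and "z \<in> edom h"
  shows "bregman h z z = 0"
  using linear_0[OF grad_linear[OF assms]] by (simp add: bregman_real[OF assms(1,3,3)])


section \<open>One step of the method\<close>

text \<open>The new iterate has a finite objective value, since the old iterate does.\<close>

lemma prox_solution_domain: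
  assumes \<Psi>: "convex_fun \<Psi>" and h: "convex_fun h" "differentiable_fun h"
    and x: "x \<in> edom h \<inter> edom \<Psi>" and sol: "prox_solution \<Psi> h \<tau> x \<gamma> x'"
  shows "x' \<in> edom h \<inter> edom \<Psi>"
proof -
  have x': "x' \<in> edom \<Psi>" using sol by (auto simp: prox_solution_def subdiff_def)
  have le: "prox_obj \<Psi> h \<tau> x \<gamma> x' \<le> prox_obj \<Psi> h \<tau> x \<gamma> x"
    using sol by (auto simp: prox_solution_def is_arg_min_def not_less)
  obtain p where p: "\<Psi> x = ereal p" using convex_fun_real[OF \<Psi>] x by blast
  obtain p' where p': "\<Psi> x' = ereal p'" using convex_fun_real[OF \<Psi>] x' by blast
  have "bregman h x' x \<noteq> \<infinity>"
    using le bregman_self[OF h] x by (auto simp: prox_obj_def p p')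
  then show ?thesis using x x' bregman_infinite[OF h(1)] by blast
qed

text \<open>The Bregman distances of the three points combine to
  \<open>\<langle>grad h x' - grad h x, s - x'\<rangle>\<close>, which the optimality condition rewrites through \<open>\<gamma>\<close> and a
  subgradient of \<open>\<Psi>\<close> at \<open>x'\<close>.\<close>

lemma prox_three_point:
  assumes \<Psi>: "convex_fun \<Psi>" and h: "convex_fun h" "differentiable_fun h"
    and \<gamma>: "linear \<gamma>" and \<tau>: "0 < \<tau>"
    and x: "x \<in> edom h \<inter> edom \<Psi>" and sol: "prox_solution \<Psi> h \<tau> x \<gamma> x'"
    and s: "s \<in> edom h \<inter> edom \<Psi>"
  shows "\<tau> * (\<gamma> x' + real_of_ereal (\<Psi> x'))
      + real_of_ereal (bregman h x' x) + real_of_ereal (bregman h s x')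
    \<le> \<tau> * (\<gamma> s + real_of_ereal (\<Psi> s)) + real_of_ereal (bregman h s x)"
proof -
  have x': "x' \<in> edom h \<inter> edom \<Psi>"
    using prox_solution_domain[OF \<Psi> h x sol] .
  obtain \<sigma> where \<sigma>: "\<sigma> \<in> subdiff \<Psi> x'"
    and opt: "\<And>v. \<tau> * (\<gamma> v + \<sigma> v) + grad h x' v - grad h x v = 0"
    using sol by (auto simp: prox_solution_def)
  have "\<Psi> x' + ereal (\<sigma> (s - x')) \<le> \<Psi> s" using \<sigma> by (simp add: subdiff_def)
  moreover obtain p where p: "\<Psi> s = ereal p" using convex_fun_real[OF \<Psi>] s by blast
  moreover obtain p' where p': "\<Psi> x' = ereal p'" using convex_fun_real[OF \<Psi>] x' by blast
  ultimately have "p' + \<sigma> (s - x') \<le> p" by simp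
  then have "\<tau> * (p' + \<sigma> (s - x')) \<le> \<tau> * p" using \<tau> by simp
  moreover have "grad h x (s - x) = grad h x (s - x') + grad h x (x' - x)"
    using linear_add[OF grad_linear[OF h, of x], of "s - x'" "x' - x"] x by simp
  moreover have "\<tau> * \<gamma> (s - x') = \<tau> * \<gamma> s - \<tau> * \<gamma> x'"
    by (simp add: linear_diff[OF \<gamma>] right_diff_distrib)
  ultimately show ?thesis
    using opt[of "s - x'"] s x x' by (simp add: bregman_real[OF h(1)] p p' algebra_simps)
qed

text \<open>Here \<open>\<epsilon>\<close> is the price, beyond the Bregman distance \<open>bregman h x' x\<close>, of evaluating the linear
  model at the old iterate instead of the new one.\<close>

lemma prox_step:
  assumes \<Psi>: "convex_fun \<Psi>" and h: "convex_fun h" "differentiable_fun h"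
    and \<gamma>: "linear \<gamma>" and \<tau>: "0 < \<tau>"
    and x: "x \<in> edom h \<inter> edom \<Psi>" and sol: "prox_solution \<Psi> h \<tau> x \<gamma> x'"
    and s: "s \<in> edom h \<inter> edom \<Psi>"
    and rel: "0 \<le> ereal \<epsilon> + ereal \<tau> * (\<Psi> x' - \<Psi> x + ereal (\<gamma> (x' - x))) + bregman h x' x"
  shows "\<tau> * (\<gamma> x + real_of_ereal (\<Psi> x)) + real_of_ereal (bregman h s x')
    \<le> \<tau> * (\<gamma> s + real_of_ereal (\<Psi> s)) + real_of_ereal (bregman h s x) + \<epsilon>"
proof -
  have x': "x' \<in> edom h \<inter> edom \<Psi>"
    using prox_solution_domain[OF \<Psi> h x sol] .
  obtain p where p: "\<Psi> x = ereal p" using convex_fun_real[OF \<Psi>] x by blast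
  obtain p' where p': "\<Psi> x' = ereal p'" using convex_fun_real[OF \<Psi>] x' by blast
  obtain d where d: "bregman h x' x = ereal d" using bregman_real[OF h(1)] x x' by blast
  have "0 \<le> \<epsilon> + \<tau> * (p' - p + \<gamma> (x' - x)) + d" using rel by (simp add: p p' d)
  moreover have "\<gamma> (x' - x) = \<gamma> x' - \<gamma> x" using \<gamma> by (rule linear_diff)
  ultimately show ?thesis
    using prox_three_point[OF \<Psi> h \<gamma> \<tau> x sol s] by (simp add: p p' d algebra_simps)
qed


section \<open>The duality gap of the averages\<close>

lemma fenchel_conj_le:
  assumes "\<And>x. x \<in> edom \<phi> \<Longrightarrow> ereal (v x) - \<phi> x \<le> B"
  shows "fenchel_conj \<phi> v \<le> B"
  unfolding fenchel_conj_def
proof (rule SUP_least)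
  fix x
  show "ereal (v x) - \<phi> x \<le> B"
    using assms by (cases "x \<in> edom \<phi>") (auto simp: notin_edom)
qed

lemma fenchel_young: "ereal (v x) - \<phi> x \<le> fenchel_conj \<phi> v"
  unfolding fenchel_conj_def by (rule SUP_upper) simp

lemma z_avg_convex_combination:
  assumes "0 < k"
  shows "z_avg t y k = (\<Sum>i<k. (t i / (\<Sum>i<k. t i)) *\<^sub>R y i)"
  using assms by (simp add: z_avg_def scaleR_sum_right divide_inverse mult.commute)

lemma u_avg_weighted: "u_avg t g k x = (\<Sum>i<k. t i / (\<Sum>i<k. t i) * g i x)"
  by (simp add: u_avg_def sum_divide_distrib)

text \<open>An average of subgradients of \<open>f\<close> has a conjugate value at most the average of the conjugate
  values of the subgradients, and Fenchel's inequality is an equality at each subgradient.\<close>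

lemma fenchel_conj_average_le:
  fixes f :: "'a::real_topological_vector \<Rightarrow> ereal"
  assumes f: "convex_fun f" and w: "\<And>i. i \<in> I \<Longrightarrow> 0 \<le> w i" "(\<Sum>i\<in>I. w i) = 1"
    and g: "\<And>i. i \<in> I \<Longrightarrow> g i \<in> subdiff f (y i)"
  shows "fenchel_conj f (\<lambda>x. \<Sum>i\<in>I. w i * g i x)
    \<le> ereal (\<Sum>i\<in>I. w i * (g i (y i) - real_of_ereal (f (y i))))"
proof (rule fenchel_conj_le)
  fix x assume "x \<in> edom f"
  then obtain a where a: "f x = ereal a" using convex_fun_real[OF f] by blast
  have "w i * (g i x - a) \<le> w i * (g i (y i) - real_of_ereal (f (y i)))" if i: "i \<in> I" for i
  proof (rule mult_left_mono)
    have "y i \<in> edom f" using g[OF i] by (simp add: subdiff_def)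
    then obtain b where b: "f (y i) = ereal b" using convex_fun_real[OF f] by blast
    have "f (y i) + ereal (g i (x - y i)) \<le> f x" using g[OF i] by (simp add: subdiff_def)
    moreover have "linear (g i)" using g[OF i] by (simp add: subdiff_def dual_def)
    ultimately show "g i x - a \<le> g i (y i) - real_of_ereal (f (y i))"
      by (simp add: a b linear_diff)
  qed (use w i in auto)
  then have "(\<Sum>i\<in>I. w i * (g i x - a)) \<le> (\<Sum>i\<in>I. w i * (g i (y i) - real_of_ereal (f (y i))))"
    by (rule sum_mono)
  moreover have "(\<Sum>i\<in>I. w i * (g i x - a)) = (\<Sum>i\<in>I. w i * g i x) - a"
    using w(2) by (simp add: right_diff_distrib sum_subtractf flip: sum_distrib_right)
  ultimately show "ereal (\<Sum>i\<in>I. w i * g i x) - f x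
    \<le> ereal (\<Sum>i\<in>I. w i * (g i (y i) - real_of_ereal (f (y i))))"
    by (simp add: a)
qed

text \<open>Summing the one-step inequalities leaves only the first and the last Bregman distance, and the
  last one has a favourable sign.\<close>

lemma telescoped_steps:
  fixes h :: "'a::real_topological_vector \<Rightarrow> ereal"
  assumes h: "convex_fun h" "differentiable_fun h"
    and s: "s \<in> edom h" and y: "y k \<in> edom h"
    and step: "\<And>i. i < k \<Longrightarrow> a i + real_of_ereal (bregman h s (y (Suc i)))
      \<le> b i + real_of_ereal (bregman h s (y i)) + \<epsilon> i"
  shows "(\<Sum>i<k. a i) \<le> (\<Sum>i<k. b i) + real_of_ereal (bregman h s (y 0)) + (\<Sum>i<k. \<epsilon> i)"
proof -
  let ?D = "\<lambda>i. real_of_ereal (bregman h s (y i))"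
  have "(\<Sum>i<k. a i) + (\<Sum>i<k. ?D (Suc i) - ?D i) \<le> (\<Sum>i<k. b i) + (\<Sum>i<k. \<epsilon> i)"
    using step by (simp flip: sum.distrib) (force intro: sum_mono)
  moreover have "(\<Sum>i<k. ?D (Suc i) - ?D i) = ?D k - ?D 0"
    by (rule sum_lessThan_telescope)
  ultimately show ?thesis using bregman_nonneg[OF h s y] by simp
qed

lemma averaged_duality_gap:
  fixes f \<Psi> h :: "'a::real_topological_vector \<Rightarrow> ereal"
  assumes f: "convex_fun f" and \<Psi>: "convex_fun \<Psi>"
    and h: "convex_fun h" "differentiable_fun h" and k: "0 < k"
    and t: "\<And>i. 0 < t i" and g: "\<And>i. g i \<in> subdiff f (y i)"
    and y: "\<And>i. y i \<in> edom h \<inter> edom \<Psi>"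
    and step: "\<And>i s. s \<in> edom h \<inter> edom \<Psi> \<Longrightarrow>
      t i * (g i (y i) + real_of_ereal (\<Psi> (y i))) + real_of_ereal (bregman h s (y (Suc i)))
      \<le> t i * (g i s + real_of_ereal (\<Psi> s)) + real_of_ereal (bregman h s (y i)) + \<epsilon> i"
  shows "f (z_avg t y k) + \<Psi> (z_avg t y k) + fenchel_conj f (u_avg t g k)
      + fenchel_conj (\<lambda>s. \<Psi> s + d_fun h t y k s) (\<lambda>x. - u_avg t g k x)
    \<le> ereal ((\<Sum>i<k. \<epsilon> i) / (\<Sum>i<k. t i))"
proof -
  define T where "T = (\<Sum>i<k. t i)"
  define w where "w = (\<lambda>i. t i / T)"
  have T: "0 < T" unfolding T_def using k t by (intro sum_pos) auto
  have w: "0 \<le> w i" "(\<Sum>i<k. w i) = 1" for i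
    using T t[of i] by (auto simp: w_def T_def simp flip: sum_divide_distrib)
  have fy: "y i \<in> edom f" for i using g[of i] by (simp add: subdiff_def)
  let ?f = "\<lambda>i. real_of_ereal (f (y i))" and ?\<Psi> = "\<lambda>i. real_of_ereal (\<Psi> (y i))"
  have z: "z_avg t y k = (\<Sum>i<k. w i *\<^sub>R y i)"
    using z_avg_convex_combination[OF k] by (simp add: w_def T_def)
  have u: "u_avg t g k = (\<lambda>x. \<Sum>i<k. w i * g i x)"
    by (rule ext) (simp add: u_avg_weighted w_def T_def)
  have 1: "f (z_avg t y k) \<le> ereal (\<Sum>i<k. w i * ?f i)"
    unfolding z by (rule convex_fun_Jensen[OF f]) (use w fy in auto)
  have 2: "\<Psi> (z_avg t y k) \<le> ereal (\<Sum>i<k. w i * ?\<Psi> i)"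
    unfolding z by (rule convex_fun_Jensen[OF \<Psi>]) (use w y in auto)
  have 3: "fenchel_conj f (u_avg t g k) \<le> ereal (\<Sum>i<k. w i * (g i (y i) - ?f i))"
    unfolding u by (rule fenchel_conj_average_le[OF f]) (use w g in auto)
  have 4: "fenchel_conj (\<lambda>s. \<Psi> s + d_fun h t y k s) (\<lambda>x. - u_avg t g k x)
    \<le> ereal ((\<Sum>i<k. \<epsilon> i) / T - (\<Sum>i<k. w i * (g i (y i) + ?\<Psi> i)))"
  proof (rule fenchel_conj_le)
    fix s assume "s \<in> edom (\<lambda>s. \<Psi> s + d_fun h t y k s)"
    then have fin: "\<Psi> s + bregman h s (y 0) / ereal T \<noteq> \<infinity>"
      by (simp add: edom_def d_fun_def T_def)
    have s\<Psi>: "s \<in> edom \<Psi>" using fin by (auto simp: edom_def)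
    have sh: "s \<in> edom h"
      using fin T bregman_infinite[OF h(1), of s "y 0"] y[of 0] by force
    obtain p where p: "\<Psi> s = ereal p" using convex_fun_real[OF \<Psi> s\<Psi>] by blast
    obtain d where d: "bregman h s (y 0) = ereal d" using bregman_real[OF h(1) sh] y[of 0] by blast
    have "(\<Sum>i<k. t i * (g i (y i) + ?\<Psi> i)) \<le> (\<Sum>i<k. t i * (g i s + p)) + d + (\<Sum>i<k. \<epsilon> i)"
      using telescoped_steps[OF h sh, of y k "\<lambda>i. t i * (g i (y i) + ?\<Psi> i)"
          "\<lambda>i. t i * (g i s + p)" \<epsilon>] y step[of s] s\<Psi> sh
      by (simp add: p d)
    then have "(\<Sum>i<k. t i * (g i (y i) + ?\<Psi> i)) / T
      \<le> ((\<Sum>i<k. t i * (g i s + p)) + d + (\<Sum>i<k. \<epsilon> i)) / T"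
      using T by (intro divide_right_mono) auto
    moreover have "(\<Sum>i<k. t i * (g i (y i) + ?\<Psi> i)) / T = (\<Sum>i<k. w i * (g i (y i) + ?\<Psi> i))"
      by (simp add: w_def sum_divide_distrib)
    moreover have "(\<Sum>i<k. t i * (g i s + p)) / T = (\<Sum>i<k. w i * g i s) + p"
    proof -
      have "(\<Sum>i<k. t i * (g i s + p)) / T = (\<Sum>i<k. w i * (g i s + p))"
        by (simp add: w_def sum_divide_distrib)
      also have "\<dots> = (\<Sum>i<k. w i * g i s) + p"
        using w(2) by (simp add: distrib_left sum.distrib flip: sum_distrib_right)
      finally show ?thesis .
    qed
    ultimately show "ereal (- u_avg t g k s) - (\<Psi> s + d_fun h t y k s)
      \<le> ereal ((\<Sum>i<k. \<epsilon> i) / T - (\<Sum>i<k. w i * (g i (y i) + ?\<Psi> i)))"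
      using T by (simp add: u d_fun_def p d add_divide_distrib flip: T_def)
  qed
  have "(\<Sum>i<k. w i * ?f i) + (\<Sum>i<k. w i * ?\<Psi> i) + (\<Sum>i<k. w i * (g i (y i) - ?f i))
      + ((\<Sum>i<k. \<epsilon> i) / T - (\<Sum>i<k. w i * (g i (y i) + ?\<Psi> i))) = (\<Sum>i<k. \<epsilon> i) / T"
    by (simp add: algebra_simps sum.distrib sum_subtractf)
  then show ?thesis
    using add_mono[OF add_mono[OF add_mono[OF 1 2] 3] 4]
    by (simp only: plus_ereal.simps(1) flip: T_def)
qed

text \<open>By Fenchel's inequality at \<open>x\<close>, the linear terms \<open>u x\<close> of the two conjugates cancel.\<close>

lemma gap_imp_suboptimality:
  fixes f \<Psi> d :: "'a \<Rightarrow> ereal"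
  assumes gap: "f z + \<Psi> z + fenchel_conj f u + fenchel_conj (\<lambda>s. \<Psi> s + d s) (\<lambda>x. - u x) \<le> ereal B"
    and fin: "\<bar>f z\<bar> \<noteq> \<infinity>" "\<bar>\<Psi> z\<bar> \<noteq> \<infinity>" and x: "f x \<noteq> -\<infinity>" "\<Psi> x \<noteq> -\<infinity>" "d x \<noteq> -\<infinity>"
  shows "f z + \<Psi> z - (f x + \<Psi> x) \<le> d x + ereal B"
proof -
  obtain a p where ap: "f z = ereal a" "\<Psi> z = ereal p"
    using fin by (cases "f z"; cases "\<Psi> z") auto
  have "f z + \<Psi> z + (ereal (u x) - f x) + (ereal (- u x) - (\<Psi> x + d x)) \<le> ereal B"
    by (rule order_trans[OF add_mono[OF add_mono[OF order_refl fenchel_young]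
            fenchel_young[of "\<lambda>x. - u x" x]] gap])
  then show ?thesis
    using x ap by (cases "f x"; cases "\<Psi> x"; cases "d x") (auto simp: algebra_simps)
qed

lemma sum_squares_constant_step:
  assumes "0 < k" and "\<And>i. i < k \<Longrightarrow> t i = C / sqrt (real k)"
  shows "(\<Sum>i<k. t i) = C * sqrt (real k)" and "(\<Sum>i<k. (t i)\<^sup>2 / 2) = C\<^sup>2 / 2"
proof -
  have "(\<Sum>i<k. t i) = C * (real k / sqrt (real k))" using assms(2) by simp
  then show "(\<Sum>i<k. t i) = C * sqrt (real k)" by (simp add: real_div_sqrt)
  show "(\<Sum>i<k. (t i)\<^sup>2 / 2) = C\<^sup>2 / 2" using assms by (simp add: power_divide)
qed


section \<open>Convergence of the Bregman proximal subgradient method\<close>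

theorem proposition4:
  fixes f \<Psi> h :: "'a::real_topological_vector \<Rightarrow> ereal"
    and P :: "real \<Rightarrow> 'a \<Rightarrow> ('a \<Rightarrow> real) \<Rightarrow> 'a option"
    and y :: "nat \<Rightarrow> 'a" and g :: "nat \<Rightarrow> 'a \<Rightarrow> real" and t :: "nat \<Rightarrow> real"
    and M :: real
  assumes "closed_convex_fun f" and "closed_convex_fun \<Psi>"
    and "edom \<Psi> \<subseteq> {x. subdiff f x \<noteq> {}}"
    and "convex_fun h" and "differentiable_fun h"
    and "edom \<Psi> \<subseteq> closure (edom h)"
    and "bounded_below (\<lambda>x. f x + \<Psi> x)"
    and "\<forall>\<tau>>0. \<forall>s'\<in>edom h. \<forall>\<gamma>\<in>dual.
           bounded_below (prox_obj \<Psi> h \<tau> s' \<gamma>) \<longrightarrow> admissible \<Psi> h \<tau> s' \<gamma>"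
    and "prox_solver \<Psi> h P"
    and "M > 0"
    and "\<forall>x \<in> edom h \<inter> edom \<Psi>. \<forall>\<gamma> \<in> subdiff f x. \<forall>s \<in> edom h \<inter> edom \<Psi>. \<forall>\<tau>>0.
           ereal (M\<^sup>2 * \<tau>\<^sup>2 / 2) + ereal \<tau> * (\<Psi> s - \<Psi> x + ereal (\<gamma> (s - x))) + bregman h s x \<ge> 0"
    and "bregman_prox_subgradient f \<Psi> h y g t"
  shows "\<forall>k\<ge>1.
      f (z_avg t y k) + \<Psi> (z_avg t y k) + fenchel_conj f (u_avg t g k)
          + fenchel_conj (\<lambda>s. \<Psi> s + d_fun h t y k s) (\<lambda>x. - u_avg t g k x)
        \<le> ereal (M\<^sup>2 * (\<Sum>i<k. (t i)\<^sup>2 / 2) / (\<Sum>i<k. t i))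
    \<and> (\<forall>x. f (z_avg t y k) + \<Psi> (z_avg t y k) - (f x + \<Psi> x)
        \<le> (bregman h x (z_avg t y 0) + ereal (M\<^sup>2 * (\<Sum>i<k. (t i)\<^sup>2 / 2))) / ereal (\<Sum>i<k. t i))
    \<and> (\<forall>C>0. (\<forall>i<k. t i = C / sqrt (real k)) \<longrightarrow>
        (\<forall>x. f (z_avg t y k) + \<Psi> (z_avg t y k) - (f x + \<Psi> x)
          \<le> bregman h x (z_avg t y 0) / ereal (C * sqrt (real k))
             + ereal (C * M\<^sup>2 / (2 * sqrt (real k)))))"
proof (intro allI impI)
  fix k :: nat assume "1 \<le> k"
  then have k: "0 < k" by simp
  have f: "convex_fun f" and \<Psi>: "convex_fun \<Psi>"
    using assms(1,2) by (auto simp: closed_convex_fun_def)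
  note h = \<open>convex_fun h\<close> \<open>differentiable_fun h\<close>
  have y0: "y 0 \<in> edom h \<inter> edom \<Psi>" and g: "g i \<in> subdiff f (y i)" and t: "0 < t i"
    and sol: "prox_solution \<Psi> h (t i) (y i) (g i) (y (Suc i))" for i
    using assms(12) by (auto simp: bregman_prox_subgradient_def)
  have y: "y i \<in> edom h \<inter> edom \<Psi>" for i
    by (induction i) (use y0 prox_solution_domain[OF \<Psi> h _ sol] in blast)+
  let ?z = "z_avg t y k" and ?T = "\<Sum>i<k. t i"
  let ?E = "M\<^sup>2 * (\<Sum>i<k. (t i)\<^sup>2 / 2)"
  have T: "0 < ?T" using k t by (intro sum_pos) auto
  have "t i * (g i (y i) + real_of_ereal (\<Psi> (y i))) + real_of_ereal (bregman h s (y (Suc i)))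
      \<le> t i * (g i s + real_of_ereal (\<Psi> s)) + real_of_ereal (bregman h s (y i)) + M\<^sup>2 * (t i)\<^sup>2 / 2"
    if "s \<in> edom h \<inter> edom \<Psi>" for i s
  proof (rule prox_step[OF \<Psi> h _ t y sol that])
    show "linear (g i)" using g[of i] by (simp add: subdiff_def dual_def)
    show "0 \<le> ereal (M\<^sup>2 * (t i)\<^sup>2 / 2)
        + ereal (t i) * (\<Psi> (y (Suc i)) - \<Psi> (y i) + ereal (g i (y (Suc i) - y i)))
        + bregman h (y (Suc i)) (y i)"
      using assms(11) y g t by blast
  qed
  from averaged_duality_gap[where \<epsilon> = "\<lambda>i. M\<^sup>2 * (t i)\<^sup>2 / 2", OF f \<Psi> h k t g y this]
  have gap: "f ?z + \<Psi> ?z + fenchel_conj f (u_avg t g k)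
      + fenchel_conj (\<lambda>s. \<Psi> s + d_fun h t y k s) (\<lambda>x. - u_avg t g k x) \<le> ereal (?E / ?T)"
    by (simp add: sum_distrib_left)
  have fin: "\<bar>\<phi> ?z\<bar> \<noteq> \<infinity>" if \<phi>: "convex_fun \<phi>" "\<And>i. y i \<in> edom \<phi>" for \<phi> :: "'a \<Rightarrow> ereal"
  proof -
    have "\<phi> ?z \<le> ereal (\<Sum>i<k. t i / ?T * real_of_ereal (\<phi> (y i)))"
      unfolding z_avg_convex_combination[OF k]
      using T t by (intro convex_fun_Jensen \<phi>) (auto simp: less_imp_le simp flip: sum_divide_distrib)
    then show ?thesis using \<phi>(1) by (auto simp: convex_fun_def)
  qed
  have "y i \<in> edom f" for i using g[of i] by (simp add: subdiff_def)
  then have finz: "\<bar>f ?z\<bar> \<noteq> \<infinity>" "\<bar>\<Psi> ?z\<bar> \<noteq> \<infinity>"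
    using y by (intro fin f \<Psi>; blast)+
  have sub: "f ?z + \<Psi> ?z - (f x + \<Psi> x) \<le> bregman h x (y 0) / ereal ?T + ereal (?E / ?T)"
    and D: "bregman h x (y 0) \<noteq> -\<infinity>" for x
  proof -
    show D: "bregman h x (y 0) \<noteq> -\<infinity>"
      using bregman_real[OF h(1), of x "y 0"] bregman_infinite[OF h(1), of x "y 0"] y0
      by (cases "x \<in> edom h") auto
    have "d_fun h t y k x \<noteq> -\<infinity>"
      using D T by (cases "bregman h x (y 0)") (auto simp: d_fun_def)
    from gap_imp_suboptimality[OF gap finz _ _ this] f \<Psi>
    show "f ?z + \<Psi> ?z - (f x + \<Psi> x) \<le> bregman h x (y 0) / ereal ?T + ereal (?E / ?T)"
      by (simp add: convex_fun_def d_fun_def)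
  qed
  have z0: "z_avg t y 0 = y 0" by (simp add: z_avg_def)
  show "f ?z + \<Psi> ?z + fenchel_conj f (u_avg t g k)
        + fenchel_conj (\<lambda>s. \<Psi> s + d_fun h t y k s) (\<lambda>x. - u_avg t g k x) \<le> ereal (?E / ?T)
    \<and> (\<forall>x. f ?z + \<Psi> ?z - (f x + \<Psi> x)
        \<le> (bregman h x (z_avg t y 0) + ereal ?E) / ereal ?T)
    \<and> (\<forall>C>0. (\<forall>i<k. t i = C / sqrt (real k)) \<longrightarrow>
        (\<forall>x. f ?z + \<Psi> ?z - (f x + \<Psi> x)
          \<le> bregman h x (z_avg t y 0) / ereal (C * sqrt (real k))
             + ereal (C * M\<^sup>2 / (2 * sqrt (real k)))))"
  proof (intro conjI allI impI)
    fix x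
    have "(bregman h x (y 0) + ereal ?E) / ereal ?T = bregman h x (y 0) / ereal ?T + ereal (?E / ?T)"
      using D[of x] T by (cases "bregman h x (y 0)") (auto simp: add_divide_distrib)
    then show "f ?z + \<Psi> ?z - (f x + \<Psi> x) \<le> (bregman h x (z_avg t y 0) + ereal ?E) / ereal ?T"
      using sub[of x] by (simp add: z0)
  next
    fix C :: real and x assume "0 < C" and "\<forall>i<k. t i = C / sqrt (real k)"
    note const = sum_squares_constant_step[OF k, of t C, rule_format]
    have eqs: "?T = C * sqrt (real k)" "?E / ?T = C * M\<^sup>2 / (2 * sqrt (real k))"
      using const \<open>\<forall>i<k. t i = C / sqrt (real k)\<close> \<open>0 < C\<close>
      by (simp_all add: power2_eq_square)
    show "f ?z + \<Psi> ?z - (f x + \<Psi> x) \<le> bregman h x (z_avg t y 0) / ereal (C * sqrt (real k))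
        + ereal (C * M\<^sup>2 / (2 * sqrt (real k)))"
      unfolding z0 eqs[symmetric] by (rule sub)
  qed (rule gap)
qed

end
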